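(* For all $R\in\mathrm{Sym}^2_b(\wedge^2\mathbb{R}^4)$, the algorithm described in the context (on input $R$) terminates and returns TRUE if and only if $\sec_R\geq0$.
   Context: Equip $\mathbb{R}^4$ with its standard inner product and $\wedge^2\mathbb{R}^4$ with the induced inner product $\langle\cdot,\cdot\rangle$ (so that $e_i\wedge e_j$, $i<j$, is an orthonormal basis). $\mathrm{Sym}^2_b(\wedge^2\mathbb{R}^4)$ is the space of symmetric endomorphisms $R$ of $\wedge^2\mathbb{R}^4$ satisfying the first Bianchi identity $\langle R(X\wedge Y),Z\wedge W\rangle+\langle R(Y\wedge Z),X\wedge W\rangle+\langle R(Z\wedge X),Y\wedge W\rangle=0$ for all $X,Y,Z,W\in\mathbb{R}^4$. $\sec_R\geq0$ means $\langle R(\sigma),\sigma\rangle\geq0$ for all $\sigma=X\wedge Y$ with $\|X\wedge Y\|=1$. The Hodge star $*$ is the symmetric endomorphism of $\wedge^2\mathbb{R}^4$ with $\langle *\alpha,\beta\rangle=\langle e_1\wedge e_2\wedge e_3\wedge e_4,\alpha\wedge\beta\rangle$. A common root-isolating partition for a finite collection of polynomials $p_i\in\mathbb{R}[x]$ is a sequence $-\infty=a_1<a_2<\dots<a_N=+\infty$ such that $p_i(a_j)\neq0$ for all $i$ and $j$, and $[a_j,a_{j+1}]$ contains exactly one root of some $p_i(x)$; if more than one $p_i(x)$ vanishes in $[a_j,a_{j+1}]$, then they must do so at the same point. Values $p(\pm\infty)$ are interpreted as limits. Such a partition is produced by combining Sturm's real root counting algorithm with Euclid's division algorithm (to compute greatest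 common divisors of polynomials). Algorithm (input $R\in\mathrm{Sym}^2_b(\wedge^2\mathbb{R}^4)$). Define $\sigma_i(x)\in\mathbb{R}[x]$, $1\leq i\leq6$, by $\det(R+x\,*-\lambda\,\mathrm{Id})=\lambda^6+\sum_{i=1}^6(-1)^i\sigma_i(x)\lambda^{6-i}$ (i.e., the $\sigma_i(x)$ are the elementary symmetric polynomials in the eigenvalues of $R+x\,*$). Let $-\infty=a_1<a_2<\dots<a_N=+\infty$ be a common root-isolating partition for $\sigma_i(x)$, $1\leq i\leq6$. Set answer := FALSE. For $j=1,\dots,N-1$: if for all $1\leq i\leq6$ with $\sigma_i(a_j)<0$ and $\sigma_i(a_{j+1})<0$ the polynomial $\sigma_i(x)$ has a root in $(a_j,a_{j+1})$, set answer := TRUE. Return answer.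
   Formalization: Identically zero σ_i are left out of the collection to be isolated, and if no remaining σ_i has a real root the partition is −∞<+∞; otherwise no partition exists (e.g. R=0, where σ_1≡0). Producing the partition is a single step, with any valid partition allowed. *)

theory Defs
  imports "HOL-Analysis.Analysis" "HOL-Computational_Algebra.Polynomial"
begin

section \<open>Bivectors in dimension four\<close>

text \<open>
  The space \<open>\<and>\<^sup>2\<real>\<^sup>4\<close> is represented by coordinates with respect to the orthonormal basis
  \<open>e\<^sub>1\<and>e\<^sub>2, e\<^sub>1\<and>e\<^sub>3, e\<^sub>1\<and>e\<^sub>4, e\<^sub>2\<and>e\<^sub>3, e\<^sub>2\<and>e\<^sub>4, e\<^sub>3\<and>e\<^sub>4\<close>, in this order, so that the induced inner
  product is the standard one of \<^typ>\<open>real^6\<close> (see \<open>inner_wedge\<close> below).  Endomorphisms are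
  identified with their matrices in this basis.
\<close>

type_synonym bivector = "real^6"

type_synonym bivector_endo = "real^6^6"

definition wedge :: "real^4 \<Rightarrow> real^4 \<Rightarrow> bivector" where
  "wedge X Y = vector
     [X$1 * Y$2 - X$2 * Y$1,
      X$1 * Y$3 - X$3 * Y$1,
      X$1 * Y$4 - X$4 * Y$1,
      X$2 * Y$3 - X$3 * Y$2,
      X$2 * Y$4 - X$4 * Y$2,
      X$3 * Y$4 - X$4 * Y$3]"

text \<open>
  \<open>wedge4 \<alpha> \<beta>\<close> is the coefficient of \<open>\<alpha> \<and> \<beta>\<close> at \<open>e\<^sub>1\<and>e\<^sub>2\<and>e\<^sub>3\<and>e\<^sub>4\<close>, that is
  \<open>\<langle>e\<^sub>1\<and>e\<^sub>2\<and>e\<^sub>3\<and>e\<^sub>4, \<alpha>\<and>\<beta>\<rangle>\<close>; compare \<open>wedge4_wedge\<close> below.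
\<close>

definition wedge4 :: "bivector \<Rightarrow> bivector \<Rightarrow> real" where
  "wedge4 \<alpha> \<beta> = \<alpha>$1 * \<beta>$6 - \<alpha>$2 * \<beta>$5 + \<alpha>$3 * \<beta>$4
              + \<alpha>$4 * \<beta>$3 - \<alpha>$5 * \<beta>$2 + \<alpha>$6 * \<beta>$1"

definition hodge_star :: bivector_endo where
  "hodge_star = (\<chi> i j. wedge4 (axis j 1) (axis i 1))"

definition Sym2b :: "bivector_endo set" where
  "Sym2b = {R. transpose R = R \<and>
     (\<forall>X Y Z W. (R *v wedge X Y) \<bullet> wedge Z W
              + (R *v wedge Y Z) \<bullet> wedge X W
              + (R *v wedge Z X) \<bullet> wedge Y W = 0)}"

definition sec_nonneg :: "bivector_endo \<Rightarrow> bool" where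
  "sec_nonneg R \<longleftrightarrow>
     (\<forall>\<sigma>. (\<exists>X Y. \<sigma> = wedge X Y \<and> norm (wedge X Y) = 1) \<longrightarrow> (R *v \<sigma>) \<bullet> \<sigma> \<ge> 0)"


subsection \<open>The coordinates agree with the invariant descriptions\<close>

lemma vector_6 [simp]:
  "(vector [a,b,c,d,e,f] :: ('a::zero)^6) $ 1 = a"
  "(vector [a,b,c,d,e,f] :: ('a::zero)^6) $ 2 = b"
  "(vector [a,b,c,d,e,f] :: ('a::zero)^6) $ 3 = c"
  "(vector [a,b,c,d,e,f] :: ('a::zero)^6) $ 4 = d"
  "(vector [a,b,c,d,e,f] :: ('a::zero)^6) $ 5 = e"
  "(vector [a,b,c,d,e,f] :: ('a::zero)^6) $ 6 = f"
  unfolding vector_def by simp_all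

lemma vector_4 [simp]:
  "(vector [a,b,c,d] :: ('a::zero)^4) $ 1 = a"
  "(vector [a,b,c,d] :: ('a::zero)^4) $ 2 = b"
  "(vector [a,b,c,d] :: ('a::zero)^4) $ 3 = c"
  "(vector [a,b,c,d] :: ('a::zero)^4) $ 4 = d"
  unfolding vector_def by simp_all

lemma exhaust_6:
  fixes x :: 6
  shows "x = 1 \<or> x = 2 \<or> x = 3 \<or> x = 4 \<or> x = 5 \<or> x = 6"
proof (induct x)
  case (of_int z)
  then have "z = 0 \<or> z = 1 \<or> z = 2 \<or> z = 3 \<or> z = 4 \<or> z = 5" by fastforce
  then show ?case by auto
qed

lemma UNIV_6: "UNIV = {1, 2, 3, 4, 5, 6::6}"
  using exhaust_6 by auto

lemma sum_6: "sum f (UNIV::6 set) = f 1 + f 2 + f 3 + f 4 + f 5 + f 6"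
  unfolding UNIV_6 by (simp add: ac_simps)

lemma inner_wedge:
  "wedge X Y \<bullet> wedge Z W = (X \<bullet> Z) * (Y \<bullet> W) - (X \<bullet> W) * (Y \<bullet> Z)"
  by (simp add: wedge_def inner_vec_def sum_6 sum_4 algebra_simps)

lemma det_4:
  "det (A::'a::comm_ring_1^4^4) =
     (A$1$1 * A$2$2 - A$1$2 * A$2$1) * (A$3$3 * A$4$4 - A$3$4 * A$4$3)
   - (A$1$1 * A$2$3 - A$1$3 * A$2$1) * (A$3$2 * A$4$4 - A$3$4 * A$4$2)
   + (A$1$1 * A$2$4 - A$1$4 * A$2$1) * (A$3$2 * A$4$3 - A$3$3 * A$4$2)
   + (A$1$2 * A$2$3 - A$1$3 * A$2$2) * (A$3$1 * A$4$4 - A$3$4 * A$4$1)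
   - (A$1$2 * A$2$4 - A$1$4 * A$2$2) * (A$3$1 * A$4$3 - A$3$3 * A$4$1)
   + (A$1$3 * A$2$4 - A$1$4 * A$2$3) * (A$3$1 * A$4$2 - A$3$2 * A$4$1)"
proof -
  have f: "finite {2::4, 3, 4}" "1 \<notin> {2::4, 3, 4}" "finite {3::4, 4}" "2 \<notin> {3::4, 4}"
    "finite {4::4}" "3 \<notin> {4::4}" by auto
  show ?thesis
    unfolding det_def UNIV_4
    unfolding sum_over_permutations_insert[OF f(1,2)]
    unfolding sum_over_permutations_insert[OF f(3,4)]
    unfolding sum_over_permutations_insert[OF f(5,6)]
    unfolding permutes_sing
    by (simp add: sign_swap_id permutation_swap_id sign_compose permutation_compose
          sign_id transpose_eq_iff algebra_simps)
qed

lemma wedge4_wedge: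
  "wedge4 (wedge X Y) (wedge Z W) = det (vector [X, Y, Z, W] :: real^4^4)"
  by (simp add: wedge4_def wedge_def det_4)

lemma inner_hodge_star: "(hodge_star *v \<alpha>) \<bullet> \<beta> = wedge4 \<alpha> \<beta>"
  by (simp add: hodge_star_def wedge4_def matrix_vector_mult_def inner_vec_def sum_6 axis_def
      algebra_simps)


section \<open>The polynomials \<open>\<sigma>\<^sub>i\<close>\<close>

text \<open>
  \<open>char_det R\<close> is \<open>det (R + x * - \<lambda> Id)\<close>, computed over \<open>\<real>[x][\<lambda>]\<close>: the outer polynomial
  variable is \<open>\<lambda>\<close>, the inner one is \<open>x\<close>.
\<close>

definition char_det :: "bivector_endo \<Rightarrow> real poly poly" where
  "char_det R = det (\<chi> i j. [: [: R$i$j, hodge_star$i$j :], if i = j then - 1 else 0 :])"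

definition sigma_poly :: "bivector_endo \<Rightarrow> nat \<Rightarrow> real poly" where
  "sigma_poly R i = (- 1) ^ i * coeff (char_det R) (6 - i)"

lemma poly_det:
  fixes A :: "'a::comm_ring_1 poly^'n^'n"
  shows "poly (det A) c = det (\<chi> i j. poly (A$i$j) c)"
  by (simp add: det_def poly_sum poly_prod of_int_poly)

lemma poly_char_det:
  "poly (poly (char_det R) [:l:]) x = det (R + x *\<^sub>R hodge_star - mat l)"
  unfolding char_det_def poly_det
  by (rule arg_cong[where f = det]) (auto simp: vec_eq_iff mat_def)

lemma degree_coeff_prod_linear:
  fixes f :: "'i \<Rightarrow> 'a::comm_ring_1 poly"
  assumes "finite S" "\<And>i. i \<in> S \<Longrightarrow> degree (f i) \<le> 1"
  shows "degree (prod f S) \<le> card S \<and> coeff (prod f S) (card S) = (\<Prod>i\<in>S. coeff (f i) 1)"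
  using assms
proof (induction S rule: finite_induct)
  case empty
  then show ?case by simp
next
  case (insert a S)
  then have IH: "degree (prod f S) \<le> card S"
      "coeff (prod f S) (card S) = (\<Prod>i\<in>S. coeff (f i) 1)" and d: "degree (f a) \<le> 1"
    by auto
  have "degree (f a * prod f S) \<le> 1 + card S"
    using degree_mult_le[of "f a" "prod f S"] IH(1) d by linarith
  moreover have "coeff (f a * prod f S) (1 + card S) = coeff (f a) 1 * coeff (prod f S) (card S)"
  proof -
    have "coeff (f a) n = coeff [:coeff (f a) 0, coeff (f a) 1:] n" for n
      using d by (cases n; cases "n - 1") (auto intro!: coeff_eq_0)
    then have e: "f a = [:coeff (f a) 0, coeff (f a) 1:]" by (rule poly_eqI)
    have z: "coeff (prod f S) (Suc (card S)) = 0" using IH(1) by (intro coeff_eq_0) simp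
    show ?thesis by (subst e) (simp add: z)
  qed
  ultimately show ?case using insert.hyps IH(2) by simp
qed

lemma char_det_monic: "degree (char_det R) \<le> 6 \<and> coeff (char_det R) 6 = 1"
proof -
  define A :: "real poly poly^6^6" where
    "A = (\<chi> i j. [: [: R$i$j, hodge_star$i$j :], if i = j then - 1 else 0 :])"
  have A: "degree (\<Prod>i\<in>UNIV. A$i$p i) \<le> 6"
    "coeff (\<Prod>i\<in>UNIV. A$i$p i) 6 = (\<Prod>i\<in>UNIV. if i = p i then - 1 else 0)" for p
    using degree_coeff_prod_linear[of UNIV "\<lambda>i. A$i$p i"] by (auto simp: A_def)
  have p: "(\<Prod>i\<in>UNIV. if i = p i then - 1 else 0) = (if p = id then 1 else (0::real poly))"
    for p :: "6 \<Rightarrow> 6"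
  proof (cases "p = id")
    case False
    then obtain i where "i \<noteq> p i" by (metis eq_id_iff)
    with False show ?thesis by (subst prod_zero) auto
  qed simp
  have oi: "(of_int z :: real poly poly) = [:of_int z:]" for z
    by (simp add: of_int_poly)
  have "degree (det A) \<le> 6"
    unfolding det_def oi using A(1) by (intro degree_sum_le) (auto intro: order.trans[OF degree_mult_le])
  moreover have "coeff (det A) 6 =
      (\<Sum>p | p permutes (UNIV::6 set). if p = id then of_int (sign p) else 0)"
    unfolding det_def oi coeff_sum by (intro sum.cong refl, simp add: A p) (simp add: id_def)
  ultimately show ?thesis
    unfolding char_det_def A_def[symmetric] by (simp add: permutes_id)
qed

text \<open>The identity by which the \<open>\<sigma>\<^sub>i\<close> are introduced.\<close>

lemma det_eq_sigma:
  "det (R + x *\<^sub>R hodge_star - mat l) =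
     l ^ 6 + (\<Sum>i = 1..6. (- 1) ^ i * poly (sigma_poly R i) x * l ^ (6 - i))"
proof -
  have "poly (char_det R) [:l:] = (\<Sum>i\<le>6. coeff (char_det R) i * [:l:] ^ i)"
    unfolding poly_altdef
    using char_det_monic[of R] by (intro sum.mono_neutral_left) (auto intro: coeff_eq_0)
  also have "\<dots> = (\<Sum>i\<le>6. coeff (char_det R) (6 - i) * [:l:] ^ (6 - i))"
    by (rule sum.reindex_bij_witness[of _ "\<lambda>i. 6 - i" "\<lambda>i. 6 - i"]) auto
  also have "{..6::nat} = insert 0 {1..6}" by auto
  finally show ?thesis
    using char_det_monic[of R]
    by (simp add: poly_char_det[symmetric] sigma_poly_def poly_sum poly_power mult.assoc[symmetric]
        power_mult_distrib[symmetric])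
qed


section \<open>Common root-isolating partitions\<close>

definition poly_at :: "real poly \<Rightarrow> ereal \<Rightarrow> ereal" where
  "poly_at p a = (case a of
       ereal x \<Rightarrow> ereal (poly p x)
     | PInfty \<Rightarrow> Lim at_top (\<lambda>x. ereal (poly p x))
     | MInfty \<Rightarrow> Lim at_bot (\<lambda>x. ereal (poly p x)))"

text \<open>
  The sequence \<open>a\<^sub>1 < \<dots> < a\<^sub>N\<close> is the list \<open>as\<close>, with \<open>a\<^sub>j = as ! (j - 1)\<close>.  Roots are counted as
  points, without multiplicity.
\<close>

definition common_root_isolating_partition :: "real poly set \<Rightarrow> ereal list \<Rightarrow> bool" where
  "common_root_isolating_partition P as \<longleftrightarrow>
     length as \<ge> 2 \<and> hd as = -\<infinity> \<and> last as = \<infinity> \<and> sorted_wrt (<) as \<and>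
     (\<forall>p\<in>P. \<forall>a\<in>set as. poly_at p a \<noteq> 0) \<and>
     (\<forall>j. Suc j < length as \<longrightarrow>
        (\<exists>!x. as ! j \<le> ereal x \<and> ereal x \<le> as ! Suc j \<and> (\<exists>p\<in>P. poly p x = 0)))"


section \<open>The algorithm\<close>

text \<open>
  A polynomial \<open>\<sigma>\<^sub>i\<close> may vanish identically (\<open>\<sigma>\<^sub>1\<close> is the constant \<open>tr R\<close>), and then no partition
  satisfies \<open>\<sigma>\<^sub>i(a\<^sub>j) \<noteq> 0\<close>; such \<open>\<sigma>\<^sub>i\<close> are never negative and are left out of the collection.
\<close>

definition sigma_collection :: "bivector_endo \<Rightarrow> real poly set" where
  "sigma_collection R = {sigma_poly R i | i. i \<in> {1..6} \<and> sigma_poly R i \<noteq> 0}"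

text \<open>
  It can also happen that no polynomial of the collection has a real root, for example if \<open>R\<close>
  interchanges self-dual and anti-self-dual bivectors isometrically.  There is then nothing to
  isolate, and the only partition is \<open>-\<infinity> < +\<infinity>\<close>.
\<close>

definition partition_for :: "bivector_endo \<Rightarrow> ereal list \<Rightarrow> bool" where
  "partition_for R as \<longleftrightarrow>
     (if \<exists>p\<in>sigma_collection R. \<exists>x. poly p x = 0
      then common_root_isolating_partition (sigma_collection R) as
      else as = [-\<infinity>, \<infinity>])"

definition interval_test :: "bivector_endo \<Rightarrow> ereal list \<Rightarrow> nat \<Rightarrow> bool" where
  "interval_test R as j \<longleftrightarrow>
     (\<forall>i\<in>{1..6}. poly_at (sigma_poly R i) (as ! j) < 0 \<and> poly_at (sigma_poly R i) (as ! Suc j) < 0 \<longrightarrow>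
        (\<exists>x. as ! j < ereal x \<and> ereal x < as ! Suc j \<and> poly (sigma_poly R i) x = 0))"

text \<open>
  The algorithm as a transition system.  The choice of the partition is nondeterministic: any
  partition may be used, and the run is stuck if there is none.  \<open>Loop as j answer\<close> is the state
  before the loop body is executed for the interval from \<open>as ! j\<close> to \<open>as ! Suc j\<close>.
\<close>

datatype alg_state =
    Start
  | Loop "ereal list" nat bool
  | Halt bool

inductive alg_step :: "bivector_endo \<Rightarrow> alg_state \<Rightarrow> alg_state \<Rightarrow> bool" for R where
  choose_partition: "partition_for R as \<Longrightarrow> alg_step R Start (Loop as 0 False)"
| loop_body: "Suc j < length as \<Longrightarrow>
    alg_step R (Loop as j answer) (Loop as (Suc j) (if interval_test R as j then True else answer))"
| loop_exit: "\<not> Suc j < length as \<Longrightarrow> alg_step R (Loop as j answer) (Halt answer)"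

text \<open>Every run is finite, and a run that cannot be continued has returned an answer.\<close>

definition alg_terminates :: "bivector_endo \<Rightarrow> bool" where
  "alg_terminates R \<longleftrightarrow>
     (\<nexists>s. s (0::nat) = Start \<and> (\<forall>n. alg_step R (s n) (s (Suc n)))) \<and>
     (\<forall>s. (alg_step R)\<^sup>*\<^sup>* Start s \<and> (\<nexists>s'. alg_step R s s') \<longrightarrow> (\<exists>b. s = Halt b))"

definition alg_returns :: "bivector_endo \<Rightarrow> bool \<Rightarrow> bool" where
  "alg_returns R b \<longleftrightarrow> (alg_step R)\<^sup>*\<^sup>* Start (Halt b)"

end

theory Submission
  imports Defs "HOL-Computational_Algebra.Fundamental_Theorem_Algebra"
begin

text \<open>
  By Thorpe's trick, which is Finsler's lemma for the forms \<open>\<langle>R \<sigma>, \<sigma>\<rangle>\<close> and \<open>\<sigma> \<and> \<sigma>\<close>, the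
  condition \<open>sec\<^sub>R \<ge> 0\<close> means that \<open>R + x *\<close> is positive semidefinite for some real \<open>x\<close>.  Since
  all eigenvalues are real, this holds at \<open>x\<close> iff all \<open>\<sigma>\<^sub>i(x) \<ge> 0\<close>.  If such an \<open>x\<close> lies in
  \<open>[a\<^sub>j, a\<^sub>j\<^sub>+\<^sub>1]\<close>, then every \<open>\<sigma>\<^sub>i\<close> negative at both endpoints has a root there by the intermediate
  value theorem.  Conversely, if the test succeeds on \<open>[a\<^sub>j, a\<^sub>j\<^sub>+\<^sub>1]\<close>, then all \<open>\<sigma>\<^sub>i\<close> are nonnegative
  at the unique point \<open>x\<close> of this interval at which roots occur (any point, if there are none): a
  \<open>\<sigma>\<^sub>i\<close> negative at \<open>x\<close> has no root in the interval, so it would be negative at both endpoints.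
\<close>

section \<open>Positive semidefiniteness and the \<open>\<sigma>\<^sub>i\<close>\<close>

lemma sym_matrix_inner:
  fixes M :: "real^'n^'n"
  assumes "transpose M = M"
  shows "(M *v x) \<bullet> y = x \<bullet> (M *v y)"
  by (metis assms dot_lmul_matrix transpose_matrix_vector)

lemma quadratic_form_add_scale:
  fixes M :: "real^'n^'n"
  assumes "transpose M = M"
  shows "(M *v (s *\<^sub>R v + t *\<^sub>R w)) \<bullet> (s *\<^sub>R v + t *\<^sub>R w) =
    s\<^sup>2 * ((M *v v) \<bullet> v) + 2 * s * t * ((M *v v) \<bullet> w) + t\<^sup>2 * ((M *v w) \<bullet> w)"
  using sym_matrix_inner[OF assms, of w v]
  by (simp add: matrix_vector_right_distrib matrix_vector_mult_scaleR inner_add_left inner_add_right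
      inner_commute power2_eq_square algebra_simps)

text \<open>Moving from \<open>v\<close> a distance proportional to \<open>t\<close> along
  \<open>- (M *v v)\<close> changes the form to first order by
  \<open>- 2 * t * (w \<bullet> w)\<close>, so a nonzero \<open>w = M *v v\<close> would make it
  negative for small \<open>t\<close>.\<close>

lemma psd_null_vector_in_kernel:
  fixes M :: "real^'n^'n"
  assumes sym: "transpose M = M" and psd: "\<And>v. 0 \<le> (M *v v) \<bullet> v" and null: "(M *v v) \<bullet> v = 0"
  shows "M *v v = 0"
proof (rule ccontr)
  define w where "w = M *v v"
  define c where "c = (M *v w) \<bullet> w"
  assume "M *v v \<noteq> 0"
  then have w: "0 < w \<bullet> w" by (simp add: w_def)
  have c: "0 \<le> c" unfolding c_def by (rule psd)
  \<comment> \<open>Nonnegativity of the form would require \<open>t * c\<close> to be at least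
    \<open>2 * (w \<bullet> w)\<close>, while this \<open>t\<close> keeps it at most
    \<open>w \<bullet> w\<close>. The summand 1 avoids division by zero.\<close>
  define t where "t = (w \<bullet> w) / (c + 1)"
  have t: "0 < t" using w c by (simp add: t_def)
  have "0 \<le> 2 * (- t) * (w \<bullet> w) + t\<^sup>2 * c"
    using psd[of "1 *\<^sub>R v + (- t) *\<^sub>R w"] null
    unfolding quadratic_form_add_scale[OF sym] by (simp add: w_def c_def)
  then have "0 \<le> t * (t * c - 2 * (w \<bullet> w))" by (simp add: power2_eq_square algebra_simps)
  then have "2 * (w \<bullet> w) \<le> t * c" using t by (simp add: zero_le_mult_iff)
  moreover have "t * c \<le> w \<bullet> w" using w c by (simp add: t_def field_simps)
  ultimately show False using w by simp
qed

lemma mat_real_vector_mult: "mat l *v v = l *\<^sub>R (v :: real^'n)"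
  by (simp add: mat_def matrix_vector_mult_def vec_eq_iff if_distrib if_distribR cong: if_cong)

text \<open>The minimum \<open>m\<close> of the form on the unit sphere is an eigenvalue:
  \<open>M - mat m\<close> is positive semidefinite, and the minimiser is a null vector of its form,
  hence in its kernel. The determinant hypothesis then excludes \<open>m < 0\<close>.\<close>

lemma psd_if_no_negative_eigenvalue:
  fixes M :: "real^'n^'n"
  assumes sym: "transpose M = M" and det: "\<And>l. l < 0 \<Longrightarrow> det (M - mat l) \<noteq> 0"
  shows "0 \<le> (M *v v) \<bullet> v"
proof -
  let ?q = "\<lambda>v. (M *v v) \<bullet> v"
  have "continuous_on (sphere 0 1) ?q"
    by (intro continuous_intros linear_continuous_on linear_linear[THEN iffD2]) simp
  then obtain u where u: "norm u = 1" and min: "\<And>v. norm v = 1 \<Longrightarrow> ?q u \<le> ?q v"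
    using continuous_attains_inf[of "sphere 0 1" ?q] by (auto simp: dist_norm)
  define m where "m = ?q u"
  have low: "m * (v \<bullet> v) \<le> ?q v" for v
  proof (cases "v = 0")
    case False
    have "m \<le> ?q ((1 / norm v) *\<^sub>R v)" unfolding m_def using False by (intro min) simp
    also have "\<dots> = ?q v / (v \<bullet> v)"
      by (simp add: matrix_vector_mult_scaleR dot_square_norm power2_eq_square)
    finally show ?thesis using False by (simp add: pos_le_divide_eq)
  qed simp
  have "(M - mat m) *v u = 0"
  proof (rule psd_null_vector_in_kernel)
    show "transpose (M - mat m) = M - mat m"
      using sym by (auto simp: transpose_def mat_def vec_eq_iff)
    show "0 \<le> ((M - mat m) *v v) \<bullet> v" for v
      using low[of v] by (simp add: matrix_vector_mult_diff_rdistrib mat_real_vector_mult inner_diff_left)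
    show "((M - mat m) *v u) \<bullet> u = 0"
      using u by (simp add: matrix_vector_mult_diff_rdistrib mat_real_vector_mult inner_diff_left
          m_def dot_square_norm)
  qed
  moreover have "u \<noteq> 0" using u by auto
  ultimately have "det (M - mat m) = 0"
    by (metis invertible_det_nz invertible_left_inverse matrix_left_invertible_ker)
  then have "0 \<le> m" using det[of m] by linarith
  then show ?thesis using low[of v] by (meson inner_ge_zero mult_nonneg_nonneg order_trans)
qed

section \<open>Complex eigenvalues and signs of coefficients\<close>

lemma kernel_nonzero_if_det_0:
  fixes A :: "'a::field^'n^'n"
  assumes "det A = 0"
  shows "\<exists>v. A *v v = 0 \<and> v \<noteq> 0"
proof -
  have "\<not> invertible A" using assms by (simp add: invertible_det_nz)
  then show ?thesis unfolding invertible_left_inverse matrix_left_invertible_ker by blast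
qed

text \<open>As \<open>z\<close> is added on the diagonal, \<open>- z\<close> is an eigenvalue of
  \<open>M\<close>. Splitting the equation of an eigenvector into its real part \<open>u\<close> and
  imaginary part \<open>w\<close>, symmetry makes \<open>z\<close> real and semidefiniteness makes
  it nonpositive.\<close>

lemma psd_complex_eigenvalue:
  fixes M :: "real^'n^'n" and z :: complex
  assumes sym: "transpose M = M" and psd: "\<And>v. 0 \<le> (M *v v) \<bullet> v"
    and det: "det (\<chi> i j. of_real (M$i$j) + (if i = j then z else 0)) = 0"
  shows "\<exists>r\<le>0. z = of_real r"
proof -
  let ?A = "(\<chi> i j. of_real (M$i$j) + (if i = j then z else 0)) :: complex^'n^'n"
  obtain v where v: "?A *v v = 0" "v \<noteq> 0"
    using kernel_nonzero_if_det_0[OF det] by blast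
  define a u w where "a = Re z" and "u = (\<chi> i. Re (v$i))" and "w = (\<chi> i. Im (v$i))"
  define b where "b = Im z"
  have eq: "(\<Sum>j\<in>UNIV. of_real (M$i$j) * v$j) + z * v$i = 0" for i
  proof -
    have "(of_real (M$i$j) + (if i = j then z else 0)) * v$j =
        of_real (M$i$j) * v$j + (if i = j then z * v$j else 0)" for j
      by (simp add: distrib_right)
    then show ?thesis
      using arg_cong[OF v(1), of "\<lambda>x. x$i"] by (simp add: matrix_vector_mult_def sum.distrib)
  qed
  have Mu: "M *v u = (- a) *\<^sub>R u + b *\<^sub>R w"
  proof (rule vec_eq_iff[THEN iffD2, rule_format])
    fix i show "(M *v u)$i = ((- a) *\<^sub>R u + b *\<^sub>R w)$i"
      using arg_cong[OF eq[of i], of Re]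
      by (simp add: matrix_vector_mult_def u_def w_def a_def b_def)
  qed
  have Mw: "M *v w = (- b) *\<^sub>R u + (- a) *\<^sub>R w"
  proof (rule vec_eq_iff[THEN iffD2, rule_format])
    fix i show "(M *v w)$i = ((- b) *\<^sub>R u + (- a) *\<^sub>R w)$i"
      using arg_cong[OF eq[of i], of Im]
      by (simp add: matrix_vector_mult_def u_def w_def a_def b_def)
  qed
  have "u \<noteq> 0 \<or> w \<noteq> 0"
    using v(2) by (auto simp: u_def w_def vec_eq_iff complex_eq_iff)
  then have pos: "0 < u \<bullet> u + w \<bullet> w"
    by (metis add_nonneg_pos add_pos_nonneg inner_ge_zero inner_gt_zero_iff)
  \<comment> \<open>In \<open>(M *v u) \<bullet> w = u \<bullet> (M *v w)\<close> the terms with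
    \<open>a\<close> cancel.\<close>
  have "b * (u \<bullet> u + w \<bullet> w) = 0"
    using sym_matrix_inner[OF sym, of u w]
    by (simp add: Mu Mw inner_add_left inner_add_right inner_commute algebra_simps)
  with pos have b: "b = 0" by simp
  have "0 \<le> (M *v u) \<bullet> u + (M *v w) \<bullet> w" using psd by (simp add: add_nonneg_nonneg)
  then have "0 \<le> (- a) * (u \<bullet> u + w \<bullet> w)" by (simp add: Mu Mw b algebra_simps)
  then have "a \<le> 0" using mult_neg_pos[OF _ pos, of "- a"] by linarith
  then show ?thesis using b by (intro exI[of _ a]) (auto simp: a_def b_def complex_eq_iff)
qed

text \<open>Over the complex numbers \<open>p\<close> is a product of factors \<open>X - r\<close>
  with \<open>r \<le> 0\<close>, whose coefficients are nonnegative. The induction splits off one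
  factor at a time.\<close>

lemma coeff_nonneg_if_roots_nonpos:
  fixes p :: "complex poly"
  assumes "lead_coeff p = 1" "\<And>z. poly p z = 0 \<Longrightarrow> \<exists>r\<le>0. z = of_real r"
  shows "\<exists>c\<ge>0. coeff p k = of_real c"
  using assms
proof (induction "degree p" arbitrary: p k)
  case 0
  then obtain a where "p = [:a:]" using degree_eq_zeroE by metis
  with 0 have "coeff p k = of_real (if k = 0 then 1 else 0)" by (auto simp: coeff_pCons split: nat.split)
  then show ?case by (metis zero_le_one order_refl)
next
  case (Suc n)
  then have "\<not> constant (poly p)" by (simp add: constant_degree)
  then obtain z where "poly p z = 0" using fundamental_theorem_of_algebra by blast
  with Suc.prems(2) obtain r where r: "r \<le> 0" "z = of_real r" "poly p (of_real r) = 0" by auto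
  then obtain q where q: "p = [:- of_real r, 1:] * q" by (metis poly_eq_0_iff_dvd dvdE)
  have "q \<noteq> 0" using q Suc.prems(1) by auto
  then have "n = degree q" using Suc.hyps(2) unfolding q by (subst (asm) degree_mult_eq) auto
  moreover have "lead_coeff q = 1" using Suc.prems(1) unfolding q lead_coeff_mult by simp
  moreover have "\<exists>r\<le>0. z = of_real r" if "poly q z = 0" for z
    using Suc.prems(2)[of z] that by (simp add: q)
  ultimately have IH: "\<exists>c\<ge>0. coeff q k = of_real c" for k using Suc.hyps(1) by blast
  obtain c where c: "0 \<le> c" "coeff q k = of_real c" using IH by blast
  \<comment> \<open>\<open>pCons 0 q\<close> is \<open>X * q\<close>, so its constant coefficient is
    0 and the others are those of \<open>q\<close>, shifted.\<close>
  obtain d where d: "0 \<le> d" "coeff (pCons 0 q) k = of_real d"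
    using IH by (cases k) (auto intro: that[of 0])
  have "coeff p k = of_real (- r * c + d)" using c d by (simp add: q)
  moreover have "0 \<le> - r * c + d" using r c d by (intro add_nonneg_nonneg mult_nonneg_nonneg) auto
  ultimately show ?case by blast
qed

lemma of_real_det:
  fixes M :: "real^'n^'n"
  shows "(of_real (det M) :: 'a::{real_algebra_1,comm_ring_1}) = det (\<chi> i j. of_real (M$i$j))"
  by (simp add: det_def)

lemma poly_eq_if_eq_on_reals:
  fixes p q :: "complex poly"
  assumes "\<And>t. poly p (of_real t) = poly q (of_real t)"
  shows "p = q"
proof (rule ccontr)
  assume "p \<noteq> q"
  then have "finite {z. poly (p - q) z = 0}" by (intro poly_roots_finite) simp
  then have "finite (range complex_of_real)" by (rule finite_subset[rotated]) (auto simp: assms)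
  then show False by (simp add: finite_image_iff inj_of_real infinite_UNIV_char_0)
qed

text \<open>Substituting \<open>- t\<close> for the eigenvalue variable cancels the alternating
  signs, because \<open>i\<close> and \<open>6 - i\<close> have the same parity. The values of the
  \<open>sigma_poly\<close> become plain coefficients.\<close>

lemma det_add_eq_sigma:
  "det (R + x *\<^sub>R hodge_star + mat t) = t ^ 6 + (\<Sum>i = 1..6. poly (sigma_poly R i) x * t ^ (6 - i))"
proof -
  have "R + x *\<^sub>R hodge_star + mat t = R + x *\<^sub>R hodge_star - mat (- t)"
    by (simp add: vec_eq_iff mat_def)
  then have "det (R + x *\<^sub>R hodge_star + mat t) =
      (- t) ^ 6 + (\<Sum>i = 1..6. (- 1) ^ i * poly (sigma_poly R i) x * (- t) ^ (6 - i))"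
    by (simp only: det_eq_sigma)
  also have "(\<Sum>i = 1..6. (- 1) ^ i * poly (sigma_poly R i) x * (- t) ^ (6 - i)) =
      (\<Sum>i = 1..6. poly (sigma_poly R i) x * t ^ (6 - i))"
  proof (intro sum.cong refl)
    fix i :: nat assume "i \<in> {1..6}"
    then have "(- 1) ^ i * (- 1 :: real) ^ (6 - i) = 1" by (simp flip: power_add)
    then show "(- 1) ^ i * poly (sigma_poly R i) x * (- t) ^ (6 - i) = poly (sigma_poly R i) x * t ^ (6 - i)"
      by (subst power_minus) (simp add: mult.left_commute mult.commute)
  qed
  finally show ?thesis by simp
qed

lemma transpose_hodge_star: "transpose hodge_star = hodge_star"
  by (simp add: transpose_def hodge_star_def vec_eq_iff wedge4_def algebra_simps)

text \<open>With nonnegative coefficients, \<open>det (?M + mat t)\<close> is positive for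
  \<open>t > 0\<close>, so \<open>?M\<close> has no negative eigenvalue. Conversely,
  semidefiniteness forces all complex roots of this monic polynomial in \<open>t\<close> to be real
  and nonpositive, so its coefficients are nonnegative.\<close>

lemma psd_iff_sigma_nonneg:
  assumes "transpose R = R"
  shows "(\<forall>v. 0 \<le> ((R + x *\<^sub>R hodge_star) *v v) \<bullet> v) \<longleftrightarrow> (\<forall>i\<in>{1..6}. 0 \<le> poly (sigma_poly R i) x)"
proof
  let ?M = "R + x *\<^sub>R hodge_star"
  have sym: "transpose ?M = ?M"
    using assms transpose_hodge_star by (simp add: transpose_def vec_eq_iff)
  show "\<forall>v. 0 \<le> (?M *v v) \<bullet> v" if nonneg: "\<forall>i\<in>{1..6}. 0 \<le> poly (sigma_poly R i) x"
  proof (intro allI psd_if_no_negative_eigenvalue[OF sym])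
    fix l :: real assume "l < 0"
    then have "0 < (- l) ^ 6 + (\<Sum>i = 1..6. poly (sigma_poly R i) x * (- l) ^ (6 - i))"
      using nonneg by (intro add_pos_nonneg sum_nonneg mult_nonneg_nonneg zero_less_power zero_le_power) auto
    moreover have "?M - mat l = ?M + mat (- l)" by (simp add: vec_eq_iff mat_def)
    ultimately have "0 < det (?M - mat l)" by (simp only: det_add_eq_sigma)
    then show "det (?M - mat l) \<noteq> 0" by simp
  qed
  show "\<forall>i\<in>{1..6}. 0 \<le> poly (sigma_poly R i) x" if psd: "\<forall>v. 0 \<le> (?M *v v) \<bullet> v"
  proof
    fix k :: nat assume k: "k \<in> {1..6}"
    \<comment> \<open>\<open>p\<close> is the expected expansion of \<open>det D\<close>. The
      expansion is available at real arguments only, which are infinitely many and thus determine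
      the polynomial.\<close>
    define p :: "complex poly" where
      "p = monom 1 6 + (\<Sum>i = 1..6. monom (of_real (poly (sigma_poly R i) x)) (6 - i))"
    define D :: "complex poly^6^6" where
      "D = (\<chi> i j. [: of_real (?M$i$j), if i = j then 1 else 0 :])"
    have D: "poly (det D) z = det (\<chi> i j. of_real (?M$i$j) + (if i = j then z else 0))" for z
      unfolding poly_det D_def by (rule arg_cong[where f = det]) (auto simp: vec_eq_iff)
    have "det D = p"
    proof (rule poly_eq_if_eq_on_reals)
      fix t :: real
      have "poly (det D) (of_real t) = of_real (det (?M + mat t))"
        unfolding D of_real_det by (rule arg_cong[where f = det]) (auto simp: vec_eq_iff mat_def)
      also have "\<dots> = poly p (of_real t)"
        by (simp add: det_add_eq_sigma p_def poly_sum poly_monom)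
      finally show "poly (det D) (of_real t) = poly p (of_real t)" .
    qed
    have coeff: "coeff p j = (if j = 6 then 1 else 0) +
        (\<Sum>i = 1..6. if 6 - i = j then of_real (poly (sigma_poly R i) x) else 0)" for j
      by (simp add: p_def coeff_sum coeff_monom if_distrib[of of_real])
    \<comment> \<open>On \<open>{1..6}\<close> truncated subtraction from 6 is injective, so a
      single summand survives.\<close>
    have "(\<Sum>i = 1..6. if 6 - i = 6 - k then complex_of_real (poly (sigma_poly R i) x) else 0) =
        (\<Sum>i = 1..6. if i = k then of_real (poly (sigma_poly R i) x) else 0)"
      using k by (intro sum.cong) auto
    then have coeff_k: "coeff p (6 - k) = of_real (poly (sigma_poly R k) x)"
      using k by (auto simp: coeff)
    have "coeff p 6 = 1" by (auto simp: coeff intro!: sum.neutral)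
    moreover have "degree p \<le> 6" by (rule degree_le) (auto simp: coeff intro!: sum.neutral)
    ultimately have "lead_coeff p = 1" by (metis le_degree le_antisym zero_neq_one)
    moreover have "\<exists>r\<le>0. z = of_real r" if "poly p z = 0" for z
      using psd_complex_eigenvalue[OF sym, of z] psd that D[of z] \<open>det D = p\<close> by auto
    ultimately obtain c where "0 \<le> c" "coeff p (6 - k) = of_real c"
      using coeff_nonneg_if_roots_nonpos by blast
    then show "0 \<le> poly (sigma_poly R k) x" using coeff_k by simp
  qed
qed

section \<open>Thorpe's trick\<close>

text \<open>
  In the plane spanned by \<open>v\<close> and \<open>w\<close> the form \<open>B\<close> is indefinite, hence has two null lines; a
  positive combination of the values of \<open>A\<close> on them eliminates the mixed term \<open>\<langle>A v, w\<rangle>\<close>.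
\<close>

lemma quadratic_forms_cross_inequality:
  fixes A B :: "real^'n^'n"
  assumes sym: "transpose A = A" "transpose B = B"
    and null: "\<And>v. (B *v v) \<bullet> v = 0 \<Longrightarrow> 0 \<le> (A *v v) \<bullet> v"
    and pos: "0 < (B *v v) \<bullet> v" and neg: "(B *v w) \<bullet> w < 0"
  shows "((A *v v) \<bullet> v) * ((B *v w) \<bullet> w) \<le> ((B *v v) \<bullet> v) * ((A *v w) \<bullet> w)"
proof -
  define a e f where "a = (A *v v) \<bullet> v" and "e = (A *v v) \<bullet> w" and "f = (A *v w) \<bullet> w"
  define b c d where "b = (B *v v) \<bullet> v" and "c = (B *v v) \<bullet> w" and "d = (B *v w) \<bullet> w"
  have bd: "0 < b" "d < 0" using pos neg by (simp_all add: b_def d_def)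
  then have "b * d < 0" by (simp add: mult_pos_neg)
  define s where "s = sqrt (c\<^sup>2 - b * d)"
  have s2: "s\<^sup>2 = c\<^sup>2 - b * d"
    unfolding s_def using \<open>b * d < 0\<close> zero_le_power2[of c] by (intro real_sqrt_pow2) linarith
  have "sqrt (c\<^sup>2) < s" unfolding s_def using \<open>b * d < 0\<close> by (intro real_sqrt_less_mono) simp
  then have s: "\<bar>c\<bar> < s" by simp
  \<comment> \<open>These two values of \<open>k\<close> are the ones for which
    \<open>d *\<^sub>R v + k *\<^sub>R w\<close> is a null vector of \<open>B\<close>.\<close>
  have A: "0 \<le> d\<^sup>2 * a + 2 * d * k * e + k\<^sup>2 * f" if "k = s - c \<or> k = - s - c" for k
  proof -
    have "d\<^sup>2 * b + 2 * d * k * c + k\<^sup>2 * d = d * (d * b + (k + c)\<^sup>2 - c\<^sup>2)"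
      by (simp add: power2_eq_square algebra_simps)
    also have "(k + c)\<^sup>2 = c\<^sup>2 - b * d" using that by (auto simp flip: s2)
    finally have "(B *v (d *\<^sub>R v + k *\<^sub>R w)) \<bullet> (d *\<^sub>R v + k *\<^sub>R w) = 0"
      unfolding quadratic_form_add_scale[OF sym(2)] by (simp add: b_def c_def d_def mult.commute)
    from null[OF this] show ?thesis
      unfolding quadratic_form_add_scale[OF sym(1)] by (simp add: a_def e_def f_def)
  qed
  let ?k = "s - c" and ?l = "- s - c"
  \<comment> \<open>The weights \<open>s + c\<close> and \<open>s - c\<close> are positive since
    \<open>\<bar>c\<bar> < s\<close>, and with them the two terms containing \<open>e\<close>
    cancel.\<close>
  have "0 \<le> (- ?l) * (d\<^sup>2 * a + 2 * d * ?k * e + ?k\<^sup>2 * f) + ?k * (d\<^sup>2 * a + 2 * d * ?l * e + ?l\<^sup>2 * f)"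
    using s by (intro add_nonneg_nonneg mult_nonneg_nonneg A) auto
  also have "\<dots> = 2 * s * (d\<^sup>2 * a - (s\<^sup>2 - c\<^sup>2) * - f)"
    by (simp add: power2_eq_square algebra_simps)
  also have "\<dots> = 2 * s * d * (d * a - b * f)"
    unfolding s2 by (simp add: power2_eq_square algebra_simps)
  finally have "0 \<le> (2 * s * d) * (d * a - b * f)" .
  moreover have "2 * s * d < 0" using s bd by (simp add: mult_pos_neg)
  ultimately have "d * a - b * f \<le> 0" by (metis mult_neg_pos not_le)
  then show ?thesis by (simp add: a_def b_def d_def f_def mult.commute)
qed

text \<open>Each vector with \<open>B\<close> positive gives a lower bound for \<open>x\<close>, and
  each with \<open>B\<close> negative an upper bound. The cross inequality puts every lower bound
  below every upper bound, so the supremum \<open>Sup S\<close> of the lower bounds is admissible.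
  Null vectors of \<open>B\<close> impose only the hypothesis \<open>null\<close>.\<close>

lemma finsler_quadratic_forms:
  fixes A B :: "real^'n^'n"
  assumes sym: "transpose A = A" "transpose B = B"
    and null: "\<And>v. (B *v v) \<bullet> v = 0 \<Longrightarrow> 0 \<le> (A *v v) \<bullet> v"
    and pos: "0 < (B *v v0) \<bullet> v0" and neg: "(B *v w0) \<bullet> w0 < 0"
  shows "\<exists>x. \<forall>v. 0 \<le> ((A + x *\<^sub>R B) *v v) \<bullet> v"
proof -
  let ?q = "\<lambda>M v. (M *v v) \<bullet> v"
  define S where "S = (\<lambda>v. - ?q A v / ?q B v) ` {v. 0 < ?q B v}"
  have frac: "- a / b \<le> - f / d" if "a * d \<le> b * f" "0 < b" "d < 0" for a b d f :: real
    using that by (simp add: divide_simps mult.commute)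
  have bound: "y \<le> - ?q A w / ?q B w" if "y \<in> S" "?q B w < 0" for y w
  proof -
    from that(1) obtain v where v: "0 < ?q B v" "y = - ?q A v / ?q B v" by (auto simp: S_def)
    show ?thesis
      unfolding v(2)
      by (intro frac quadratic_forms_cross_inequality[OF sym null] v(1) that(2))
  qed
  have S: "S \<noteq> {}" "bdd_above S"
    using pos bound[OF _ neg] by (auto simp: S_def intro!: bdd_aboveI)
  have "0 \<le> ?q A v + Sup S * ?q B v" for v
  proof (cases "?q B v" "0 :: real" rule: linorder_cases)
    case less
    then have "Sup S \<le> - ?q A v / ?q B v" using S(1) bound by (intro cSup_least) auto
    with less show ?thesis by (simp add: field_simps)
  next
    case greater
    then have "- ?q A v / ?q B v \<le> Sup S" using S(2) by (intro cSup_upper) (auto simp: S_def)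
    with greater show ?thesis by (simp add: field_simps)
  qed (simp add: null)
  then show ?thesis
    by (intro exI[of _ "Sup S"])
      (simp add: matrix_vector_mult_add_rdistrib scaleR_matrix_vector_assoc[symmetric] inner_add_left)
qed

section \<open>Decomposable bivectors and sectional curvature\<close>

lemma wedge4_wedge_self: "wedge4 (wedge X Y) (wedge X Y) = 0"
  by (simp add: wedge4_def wedge_def algebra_simps)

text \<open>The hypothesis is the Pluecker relation. If the entry at \<open>(p, q)\<close> of the
  skew 4x4 matrix of coordinates is nonzero, rows \<open>p\<close> and \<open>q\<close> span the
  plane of \<open>\<sigma>\<close>. The witnesses are these rows up to sign, one of them divided by
  that entry.\<close>

lemma decomposable_if_null:
  assumes "wedge4 \<sigma> \<sigma> = 0"
  shows "\<exists>X Y. \<sigma> = wedge X Y"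
proof -
  have pl: "\<sigma>$1 * \<sigma>$6 - \<sigma>$2 * \<sigma>$5 + \<sigma>$3 * \<sigma>$4 = 0"
    using assms by (simp add: wedge4_def algebra_simps)
  have ext: "\<sigma> = wedge X Y" if "\<sigma>$1 = wedge X Y$1" "\<sigma>$2 = wedge X Y$2" "\<sigma>$3 = wedge X Y$3"
      "\<sigma>$4 = wedge X Y$4" "\<sigma>$5 = wedge X Y$5" "\<sigma>$6 = wedge X Y$6" for X Y
    unfolding vec_eq_iff
  proof
    show "\<sigma>$i = wedge X Y$i" for i using exhaust_6[of i] that by (elim disjE) simp_all
  qed
  consider "\<sigma>$1 \<noteq> 0" | "\<sigma>$2 \<noteq> 0" | "\<sigma>$3 \<noteq> 0" | "\<sigma>$4 \<noteq> 0" | "\<sigma>$5 \<noteq> 0" | "\<sigma>$6 \<noteq> 0"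
    | "\<sigma>$1 = 0" "\<sigma>$2 = 0" "\<sigma>$3 = 0" "\<sigma>$4 = 0" "\<sigma>$5 = 0" "\<sigma>$6 = 0"
    by blast
  then show ?thesis
  proof cases
    case 1
    have "\<sigma> = wedge (vector [1, 0, - \<sigma>$4 / \<sigma>$1, - \<sigma>$5 / \<sigma>$1]) (vector [0, \<sigma>$1, \<sigma>$2, \<sigma>$3])"
      using 1 pl by (intro ext) (simp_all add: wedge_def field_simps)
    then show ?thesis by blast
  next
    case 2
    have "\<sigma> = wedge (vector [1, \<sigma>$4 / \<sigma>$2, 0, - \<sigma>$6 / \<sigma>$2]) (vector [0, \<sigma>$1, \<sigma>$2, \<sigma>$3])"
      using 2 pl by (intro ext) (simp_all add: wedge_def field_simps)
    then show ?thesis by blast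
  next
    case 3
    have "\<sigma> = wedge (vector [1, \<sigma>$5 / \<sigma>$3, \<sigma>$6 / \<sigma>$3, 0]) (vector [0, \<sigma>$1, \<sigma>$2, \<sigma>$3])"
      using 3 pl by (intro ext) (simp_all add: wedge_def field_simps)
    then show ?thesis by blast
  next
    case 4
    have "\<sigma> = wedge (vector [- \<sigma>$2 / \<sigma>$4, - 1, 0, \<sigma>$6 / \<sigma>$4]) (vector [\<sigma>$1, 0, - \<sigma>$4, - \<sigma>$5])"
      using 4 pl by (intro ext) (simp_all add: wedge_def field_simps)
    then show ?thesis by blast
  next
    case 5
    have "\<sigma> = wedge (vector [- \<sigma>$3 / \<sigma>$5, - 1, - \<sigma>$6 / \<sigma>$5, 0]) (vector [\<sigma>$1, 0, - \<sigma>$4, - \<sigma>$5])"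
      using 5 pl by (intro ext) (simp_all add: wedge_def field_simps)
    then show ?thesis by blast
  next
    case 6
    have "\<sigma> = wedge (vector [\<sigma>$3 / \<sigma>$6, \<sigma>$5 / \<sigma>$6, 1, 0]) (vector [- \<sigma>$2, - \<sigma>$4, 0, \<sigma>$6])"
      using 6 pl by (intro ext) (simp_all add: wedge_def field_simps)
    then show ?thesis by blast
  next
    case 7
    then have "\<sigma> = wedge 0 0" by (intro ext) (simp_all add: wedge_def)
    then show ?thesis by blast
  qed
qed

text \<open>Decomposable bivectors are exactly the null vectors of \<open>wedge4\<close>, and
  homogeneity removes the normalisation.\<close>

lemma sec_nonneg_iff_null:
  "sec_nonneg R \<longleftrightarrow> (\<forall>\<sigma>. wedge4 \<sigma> \<sigma> = 0 \<longrightarrow> 0 \<le> (R *v \<sigma>) \<bullet> \<sigma>)"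
proof
  assume sec: "sec_nonneg R"
  show "\<forall>\<sigma>. wedge4 \<sigma> \<sigma> = 0 \<longrightarrow> 0 \<le> (R *v \<sigma>) \<bullet> \<sigma>"
  proof (intro allI impI)
    fix \<sigma> assume null: "wedge4 \<sigma> \<sigma> = 0"
    define \<tau> where "\<tau> = (1 / norm \<sigma>) *\<^sub>R \<sigma>"
    have eq: "\<sigma> = norm \<sigma> *\<^sub>R \<tau>" by (simp add: \<tau>_def)
    show "0 \<le> (R *v \<sigma>) \<bullet> \<sigma>"
    proof (cases "\<sigma> = 0")
      case False
      have "wedge4 \<tau> \<tau> = (1 / norm \<sigma>)\<^sup>2 * wedge4 \<sigma> \<sigma>"
        by (simp add: wedge4_def \<tau>_def power2_eq_square algebra_simps)
      with null have "\<exists>X Y. \<tau> = wedge X Y" by (intro decomposable_if_null) simp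
      moreover have "norm \<tau> = 1" using False by (simp add: \<tau>_def)
      ultimately have "0 \<le> (R *v \<tau>) \<bullet> \<tau>" using sec unfolding sec_nonneg_def by blast
      then show ?thesis by (subst (1 2) eq) (simp add: matrix_vector_mult_scaleR)
    qed simp
  qed
qed (auto simp: sec_nonneg_def wedge4_wedge_self)

lemma sec_nonneg_iff_exists_psd:
  assumes "transpose R = R"
  shows "sec_nonneg R \<longleftrightarrow> (\<exists>x. \<forall>v. 0 \<le> ((R + x *\<^sub>R hodge_star) *v v) \<bullet> v)"
proof
  assume sec: "sec_nonneg R"
  \<comment> \<open>The self-dual \<open>e1 \<and> e2 + e3 \<and> e4\<close> and the anti-self-dual
    \<open>e1 \<and> e2 - e3 \<and> e4\<close> show that the form of \<open>hodge_star\<close> is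
    indefinite.\<close>
  have "0 < (hodge_star *v vector [1, 0, 0, 0, 0, 1]) \<bullet> vector [1, 0, 0, 0, 0, 1]"
    "(hodge_star *v vector [1, 0, 0, 0, 0, - 1]) \<bullet> vector [1, 0, 0, 0, 0, - 1] < 0"
    by (simp_all add: inner_hodge_star wedge4_def)
  with sec show "\<exists>x. \<forall>v. 0 \<le> ((R + x *\<^sub>R hodge_star) *v v) \<bullet> v"
    unfolding sec_nonneg_iff_null
    by (intro finsler_quadratic_forms[OF assms transpose_hodge_star]) (auto simp: inner_hodge_star)
next
  assume "\<exists>x. \<forall>v. 0 \<le> ((R + x *\<^sub>R hodge_star) *v v) \<bullet> v"
  then obtain x where "\<And>v. 0 \<le> (R *v v) \<bullet> v + x * wedge4 v v"
    by (auto simp: matrix_vector_mult_add_rdistrib scaleR_matrix_vector_assoc[symmetric]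
        inner_add_left inner_hodge_star)
  then have "0 \<le> (R *v v) \<bullet> v" if "wedge4 v v = 0" for v
    using that by (metis add.right_neutral mult_zero_right)
  then show "sec_nonneg R" unfolding sec_nonneg_iff_null by blast
qed

section \<open>Root-isolating partitions\<close>

lemma filterlim_poly_at_top:
  fixes p :: "real poly"
  assumes "0 < degree p" "0 < lead_coeff p"
  shows "filterlim (poly p) at_top at_top"
  using assms
proof (induction p)
  case (pCons a p)
  then have p: "p \<noteq> 0" "0 < lead_coeff p" by (auto split: if_splits)
  have "filterlim (\<lambda>x. x * poly p x) at_top at_top"
  proof (cases "degree p = 0")
    case True
    then obtain c where "p = [:c:]" using degree_eq_zeroE by blast
    then show ?thesis
      using p by (simp add: filterlim_at_top_mult_tendsto_pos[OF tendsto_const _ filterlim_ident])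
  next
    case False
    then show ?thesis
      using pCons.IH p by (intro filterlim_at_top_mult_at_top filterlim_ident) auto
  qed
  then show ?case
    by (simp add: filterlim_tendsto_add_at_top[OF tendsto_const])
qed simp

text \<open>\<open>poly_at\<close> uses \<open>Lim\<close>, which is informative only where a limit
  exists. That limit is the constant value or an infinity, hence nonzero unless
  \<open>p = 0\<close>.\<close>

lemma poly_limit_at_top:
  fixes p :: "real poly"
  shows "\<exists>L. ((\<lambda>x. ereal (poly p x)) \<longlongrightarrow> L) at_top \<and> (p \<noteq> 0 \<longrightarrow> L \<noteq> 0)"
proof (cases "degree p = 0")
  case True
  then obtain c where "p = [:c:]" using degree_eq_zeroE by blast
  then show ?thesis by (intro exI[of _ "ereal c"]) auto
next
  case False
  then consider "0 < lead_coeff p" | "0 < lead_coeff (- p)"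
    by (metis degree_0 leading_coeff_0_iff lead_coeff_minus neg_0_less_iff_less linorder_less_linear)
  then show ?thesis
  proof cases
    case 1
    then show ?thesis
      using False filterlim_poly_at_top[of p]
      by (intro exI[of _ \<infinity>]) (simp add: tendsto_PInfty_eq_at_top)
  next
    case 2
    then have "filterlim (\<lambda>x. - poly p x) at_top at_top"
      using False filterlim_poly_at_top[of "- p"] by (simp flip: poly_minus)
    then have "((\<lambda>x. ereal (- poly p x)) \<longlongrightarrow> \<infinity>) at_top"
      by (simp add: tendsto_PInfty_eq_at_top)
    from tendsto_uminus_ereal[OF this]
    have "((\<lambda>x. ereal (poly p x)) \<longlongrightarrow> - \<infinity>) at_top" by simp
    then show ?thesis by (intro exI[of _ "- \<infinity>"]) simp
  qed
qed

lemma poly_limit_at_bot: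
  fixes p :: "real poly"
  shows "\<exists>L. ((\<lambda>x. ereal (poly p x)) \<longlongrightarrow> L) at_bot \<and> (p \<noteq> 0 \<longrightarrow> L \<noteq> 0)"
proof -
  \<comment> \<open>Composition with \<open>[:0, -1:]\<close> reflects the line and reduces to the
    limit at the other end.\<close>
  obtain L where L: "((\<lambda>x. ereal (poly (p \<circ>\<^sub>p [:0, -1:]) x)) \<longlongrightarrow> L) at_top"
      "p \<circ>\<^sub>p [:0, -1:] \<noteq> 0 \<longrightarrow> L \<noteq> 0"
    using poly_limit_at_top by blast
  have "((\<lambda>x. ereal (poly p x)) \<longlongrightarrow> L) at_bot"
    using L(1) by (simp add: filterlim_at_bot_mirror poly_pcompose)
  moreover have "p \<circ>\<^sub>p [:0, -1:] \<noteq> 0" if "p \<noteq> 0"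
    using that by (simp add: pcompose_eq_0_iff)
  ultimately show ?thesis using L(2) by blast
qed

lemma poly_at_ereal [simp]: "poly_at p (ereal x) = ereal (poly p x)"
  by (simp add: poly_at_def)

lemma tendsto_poly_at_infinity: "((\<lambda>x. ereal (poly p x)) \<longlongrightarrow> poly_at p \<infinity>) at_top"
proof -
  obtain L where L: "((\<lambda>x. ereal (poly p x)) \<longlongrightarrow> L) at_top"
    using poly_limit_at_top by blast
  with tendsto_Lim[OF trivial_limit_at_top_linorder L] show ?thesis by (simp add: poly_at_def)
qed

lemma tendsto_poly_at_minus_infinity: "((\<lambda>x. ereal (poly p x)) \<longlongrightarrow> poly_at p (- \<infinity>)) at_bot"
proof -
  obtain L where L: "((\<lambda>x. ereal (poly p x)) \<longlongrightarrow> L) at_bot"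
    using poly_limit_at_bot by blast
  with tendsto_Lim[OF trivial_limit_at_bot_linorder L] show ?thesis by (simp add: poly_at_def)
qed

lemma poly_at_infinity_nonzero:
  assumes "p \<noteq> 0" "\<bar>a\<bar> = \<infinity>"
  shows "poly_at p a \<noteq> 0"
proof -
  obtain L where L: "((\<lambda>x. ereal (poly p x)) \<longlongrightarrow> L) at_top" "L \<noteq> 0"
    using poly_limit_at_top[of p] assms(1) by blast
  obtain M where M: "((\<lambda>x. ereal (poly p x)) \<longlongrightarrow> M) at_bot" "M \<noteq> 0"
    using poly_limit_at_bot[of p] assms(1) by blast
  have "poly_at p \<infinity> = L" "poly_at p (- \<infinity>) = M"
    using tendsto_unique[OF trivial_limit_at_top_linorder tendsto_poly_at_infinity L(1)]
      tendsto_unique[OF trivial_limit_at_bot_linorder tendsto_poly_at_minus_infinity M(1)] by auto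
  with L(2) M(2) assms(2) show ?thesis by (cases a) auto
qed

section \<open>Roots from sign changes up to possibly infinite endpoints\<close>

lemma poly_neg_near_left_endpoint:
  assumes "poly_at p a < 0" "a \<le> ereal c"
  obtains x where "a \<le> ereal x" "x \<le> c" "poly p x < 0"
proof (cases a)
  case (real r)
  with assms that show ?thesis by force
next
  case MInf
  then have "eventually (\<lambda>x. poly p x < 0) at_bot"
    using order_tendstoD(2)[OF tendsto_poly_at_minus_infinity, of p 0] assms(1) by simp
  then obtain b where "\<And>x. x \<le> b \<Longrightarrow> poly p x < 0"
    by (auto simp: eventually_at_bot_linorder)
  with that[of "min b c"] MInf show ?thesis by simp
qed (use assms in auto)

lemma poly_neg_near_right_endpoint:
  assumes "poly_at p b < 0" "ereal c \<le> b"
  obtains x where "ereal x \<le> b" "c \<le> x" "poly p x < 0"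
proof (cases b)
  case (real r)
  with assms that show ?thesis by force
next
  case PInf
  then have "eventually (\<lambda>x. poly p x < 0) at_top"
    using order_tendstoD(2)[OF tendsto_poly_at_infinity, of p 0] assms(1) by simp
  then obtain m where "\<And>x. m \<le> x \<Longrightarrow> poly p x < 0"
    by (auto simp: eventually_at_top_linorder)
  with that[of "max m c"] PInf show ?thesis by simp
qed (use assms in auto)

lemma poly_at_uminus: "poly_at (- p) a = - poly_at p a"
proof (cases a)
  case PInf
  have "((\<lambda>x. ereal (poly (- p) x)) \<longlongrightarrow> - poly_at p \<infinity>) at_top"
    using tendsto_uminus_ereal[OF tendsto_poly_at_infinity[of p]] by simp
  then show ?thesis
    using tendsto_unique[OF trivial_limit_at_top_linorder tendsto_poly_at_infinity] PInf by simp
next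
  case MInf
  have "((\<lambda>x. ereal (poly (- p) x)) \<longlongrightarrow> - poly_at p (- \<infinity>)) at_bot"
    using tendsto_uminus_ereal[OF tendsto_poly_at_minus_infinity[of p]] by simp
  then show ?thesis
    using tendsto_unique[OF trivial_limit_at_bot_linorder tendsto_poly_at_minus_infinity] MInf
    by simp
qed simp

text \<open>A real point of negative value between \<open>a\<close> and \<open>c\<close> replaces
  the possibly infinite \<open>a\<close> in the intermediate value theorem. The root differs from
  that point, so it lies strictly beyond \<open>a\<close>.\<close>

lemma poly_root_left_of_nonneg:
  assumes "poly_at p a < 0" "a \<le> ereal c" "0 \<le> poly p c"
  obtains x where "a < ereal x" "x \<le> c" "poly p x = 0"
proof -
  obtain y where y: "a \<le> ereal y" "y \<le> c" "poly p y < 0"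
    using poly_neg_near_left_endpoint assms(1,2) .
  obtain x where x: "y \<le> x" "x \<le> c" "poly p x = 0"
    using IVT'[of "poly p" y 0 c] y assms(3)
    by (auto intro: continuous_at_imp_continuous_on poly_isCont)
  with y(3) have "ereal y < ereal x" by (cases "y = x") auto
  with y(1) have "a < ereal x" by (rule le_less_trans)
  with x that show ?thesis by blast
qed

lemma poly_root_right_of_nonneg:
  assumes "poly_at p b < 0" "ereal c \<le> b" "0 \<le> poly p c"
  obtains x where "ereal x < b" "c \<le> x" "poly p x = 0"
proof -
  obtain y where y: "ereal y \<le> b" "c \<le> y" "poly p y < 0"
    using poly_neg_near_right_endpoint assms(1,2) .
  obtain x where x: "c \<le> x" "x \<le> y" "poly p x = 0"
    using IVT2'[of "poly p" y 0 c] y assms(3)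
    by (auto intro: continuous_at_imp_continuous_on poly_isCont)
  with y(3) have "ereal x < ereal y" by (cases "y = x") auto
  then have "ereal x < b" using y(1) by (rule less_le_trans)
  with x that show ?thesis by blast
qed

text \<open>The midpoints between consecutive roots of all members of \<open>P\<close>, together
  with the two infinities, separate the roots.\<close>

lemma exists_common_root_isolating_partition:
  assumes fin: "finite P" and nz: "0 \<notin> P" and root: "\<exists>p\<in>P. \<exists>x. poly p x = 0"
  shows "\<exists>as. common_root_isolating_partition P as"
proof -
  define X where "X = {x. \<exists>p\<in>P. poly p x = 0}"
  have "X = (\<Union>p\<in>P. {x. poly p x = 0})" by (auto simp: X_def)
  moreover have "finite {x. poly p x = 0}" if "p \<in> P" for p
    using nz that by (intro poly_roots_finite) auto
  ultimately have X: "finite X" "X \<noteq> {}" using fin root by (auto simp: X_def)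
  define xs where "xs = sorted_list_of_set X"
  define n where "n = length xs"
  have n: "0 < n" using X by (auto simp: n_def xs_def)
  have mono: "xs ! i < xs ! j" if "i < j" "j < n" for i j
    using that sorted_wrt_nth_less[OF strict_sorted_list_of_set] by (simp add: xs_def n_def)
  have set_xs: "x \<in> X \<longleftrightarrow> (\<exists>k<n. x = xs ! k)" for x
    using X(1) by (metis in_set_conv_nth n_def set_sorted_list_of_set xs_def)
  \<comment> \<open>\<open>f k\<close> separates \<open>xs ! (k - 1)\<close> from
    \<open>xs ! k\<close>, so the \<open>n\<close> roots give \<open>n + 1\<close> partition
    points.\<close>
  define f :: "nat \<Rightarrow> ereal" where
    "f k = (if k = 0 then - \<infinity> else if k = n then \<infinity> else ereal ((xs ! (k - 1) + xs ! k) / 2))" for k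
  have above: "f k < ereal (xs ! j)" if "k \<le> j" "j < n" for k j
  proof -
    have "f k < ereal (xs ! k)" using that mono[of "k - 1" k] by (auto simp: f_def)
    also have "\<dots> \<le> ereal (xs ! j)" using mono[of k j] that by (cases "k = j") auto
    finally show ?thesis .
  qed
  have below: "ereal (xs ! j) < f k" if "j < k" "k \<le> n" for k j
  proof -
    have "j < k - 1 \<or> j = k - 1" "k - 1 < n" using that by linarith+
    then have "ereal (xs ! j) \<le> ereal (xs ! (k - 1))"
      using mono[of j "k - 1"] by auto
    also have "\<dots> < f k" using that mono[of "k - 1" k] by (auto simp: f_def)
    finally show ?thesis .
  qed
  define as where "as = map f [0..<Suc n]"
  have len: "length as = Suc n" and nth: "\<And>k. k \<le> n \<Longrightarrow> as ! k = f k"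
    by (auto simp: as_def simp del: upt_Suc)
  have sorted: "sorted_wrt (<) as"
    unfolding sorted_wrt_iff_nth_less len
  proof (intro allI impI)
    fix i j assume "i < j" "j < Suc n"
    then show "as ! i < as ! j"
      using less_trans[OF above[of i i] below[of i j]] nth[of i] nth[of j] by simp
  qed
  have off: "ereal x \<noteq> f k" if "x \<in> X" "k \<le> n" for x k
  proof -
    from that(1) obtain i where "i < n" "x = xs ! i" unfolding set_xs by blast
    then show ?thesis using above[of k i] below[of i k] that(2) by (cases "i < k") auto
  qed
  have "poly_at p a \<noteq> 0" if "p \<in> P" "a \<in> set as" for p a
  proof (cases a)
    case (real r)
    from that(2) obtain k where "k \<le> n" "a = f k" by (auto simp: as_def less_Suc_eq_le simp del: upt_Suc)
    with off[of r k] real have "r \<notin> X" by auto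
    with that real show ?thesis by (auto simp: X_def)
  qed (use that nz poly_at_infinity_nonzero[of p a] in auto)
  moreover have "\<exists>!x. as ! j \<le> ereal x \<and> ereal x \<le> as ! Suc j \<and> (\<exists>p\<in>P. poly p x = 0)"
    if "Suc j < length as" for j
  proof (rule ex1I[of _ "xs ! j"])
    have j: "j < n" using that len by simp
    then have "xs ! j \<in> X" using set_xs by blast
    then show "as ! j \<le> ereal (xs ! j) \<and> ereal (xs ! j) \<le> as ! Suc j \<and> (\<exists>p\<in>P. poly p (xs ! j) = 0)"
      using above[of j j] below[of j "Suc j"] j by (auto simp: nth X_def intro: less_imp_le)
    fix x assume x: "as ! j \<le> ereal x \<and> ereal x \<le> as ! Suc j \<and> (\<exists>p\<in>P. poly p x = 0)"
    then obtain k where k: "k < n" "x = xs ! k" using set_xs[of x] by (auto simp: X_def)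
    with x j have "\<not> k < j" "\<not> Suc j \<le> k"
      using below[of k j] above[of "Suc j" k] by (auto simp: nth)
    then show "x = xs ! j" using k by (metis less_Suc_eq_le not_less le_antisym)
  qed
  moreover have "hd as = - \<infinity>" "last as = \<infinity>"
    using nth[of 0] nth[of n] n len by (auto simp: hd_conv_nth last_conv_nth f_def as_def simp del: upt_Suc)
  ultimately have "common_root_isolating_partition P as"
    using len n sorted unfolding common_root_isolating_partition_def by auto
  then show ?thesis ..
qed

lemma partition_interval_containing:
  assumes "length as \<ge> 2" "hd as = - \<infinity>" "last as = (\<infinity>::ereal)"
  obtains j where "Suc j < length as" "as ! j \<le> ereal x" "ereal x \<le> as ! Suc j"
proof -
  \<comment> \<open>The last index is excluded so that \<open>Suc j\<close> is still an index of the
    list.\<close>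
  define j where "j = (GREATEST k. k < length as - 1 \<and> as ! k \<le> ereal x)"
  have 0: "0 < length as - 1 \<and> as ! 0 \<le> ereal x"
    using assms by (cases as) auto
  have j: "j < length as - 1 \<and> as ! j \<le> ereal x"
    unfolding j_def by (rule GreatestI_nat[of _ 0 "length as"]) (use 0 in auto)
  have "ereal x \<le> as ! Suc j"
  proof (cases "Suc j < length as - 1")
    case True
    show ?thesis
    proof (rule ccontr)
      assume "\<not> ?thesis"
      then have "Suc j \<le> j"
        unfolding j_def using True by (intro Greatest_le_nat[of _ _ "length as"]) (auto simp: j_def)
      then show False by simp
    qed
  next
    case False
    then have "as ! Suc j = last as"
      using j by (subst last_conv_nth) (auto intro!: arg_cong[where f = "(!) as"])
    then show ?thesis using assms(3) by simp
  qed
  moreover have "Suc j < length as" using j by linarith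
  ultimately show ?thesis using j that by blast
qed

section \<open>The algorithm\<close>

lemma interval_test_iff:
  assumes part: "partition_for R as"
  shows "(\<exists>j. Suc j < length as \<and> interval_test R as j) \<longleftrightarrow>
    (\<exists>x. \<forall>i\<in>{1..6}. 0 \<le> poly (sigma_poly R i) x)"
proof
  have crip: "common_root_isolating_partition (sigma_collection R) as"
    if "p \<in> sigma_collection R" "poly p x = 0" for p x
    using part that unfolding partition_for_def by metis
  have coll: "sigma_poly R i \<in> sigma_collection R" if "i \<in> {1..6}" "sigma_poly R i \<noteq> 0" for i
    using that by (auto simp: sigma_collection_def)
  have collD: "p \<noteq> 0" if "p \<in> sigma_collection R" for p
    using that by (auto simp: sigma_collection_def)
  \<comment> \<open>For the list without inner points, nonvanishing holds because nonzero
    polynomials have nonzero limits.\<close>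
  have ends: "length as \<ge> 2" "hd as = - \<infinity>" "last as = \<infinity>" and
    nonzero: "\<And>p a. p \<in> sigma_collection R \<Longrightarrow> a \<in> set as \<Longrightarrow> poly_at p a \<noteq> 0"
    using part collD
    by (auto simp: partition_for_def common_root_isolating_partition_def poly_at_infinity_nonzero
        split: if_splits)
  {
    assume "\<exists>x. \<forall>i\<in>{1..6}. 0 \<le> poly (sigma_poly R i) x"
    then obtain x where x: "\<And>i. i \<in> {1..6} \<Longrightarrow> 0 \<le> poly (sigma_poly R i) x" by blast
    obtain j where j: "Suc j < length as" "as ! j \<le> ereal x" "ereal x \<le> as ! Suc j"
      using partition_interval_containing ends .
    have "interval_test R as j"
      unfolding interval_test_def
    proof (intro ballI impI, elim conjE)
      fix i :: nat
      let ?p = "sigma_poly R i"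
      assume i: "i \<in> {1..6}" and l: "poly_at ?p (as ! j) < 0" and r: "poly_at ?p (as ! Suc j) < 0"
      obtain y where y: "as ! j < ereal y" "y \<le> x" "poly ?p y = 0"
        using poly_root_left_of_nonneg[OF l j(2) x[OF i]] .
      have "ereal y \<le> as ! Suc j" using y(2) j(3) by (meson ereal_less_eq(3) order_trans)
      \<comment> \<open>The polynomial is negative at the right endpoint, so the root is
        interior.\<close>
      moreover have "ereal y \<noteq> as ! Suc j" using y(3) r by (metis less_irrefl poly_at_ereal zero_ereal_def)
      ultimately show "\<exists>x. as ! j < ereal x \<and> ereal x < as ! Suc j \<and> poly ?p x = 0"
        using y by (auto simp: order_less_le)
    qed
    with j(1) show "\<exists>j. Suc j < length as \<and> interval_test R as j" by blast
  }
  assume "\<exists>j. Suc j < length as \<and> interval_test R as j"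
  then obtain j where j: "Suc j < length as" "interval_test R as j" by blast
  let ?root = "\<lambda>x. as ! j \<le> ereal x \<and> ereal x \<le> as ! Suc j \<and> (\<exists>p\<in>sigma_collection R. poly p x = 0)"
  obtain x where x: "as ! j \<le> ereal x" "ereal x \<le> as ! Suc j"
    and unique: "\<And>y. ?root y \<Longrightarrow> y = x"
  proof (cases "\<exists>p\<in>sigma_collection R. \<exists>x. poly p x = 0")
    case True
    then have "common_root_isolating_partition (sigma_collection R) as" using crip by blast
    then have "\<exists>!x. ?root x"
      using j(1) unfolding common_root_isolating_partition_def by blast
    then show ?thesis using that by blast
  next
    case False
    then have "as = [- \<infinity>, \<infinity>]" using part unfolding partition_for_def by simp
    \<comment> \<open>Without roots uniqueness is vacuous, and 0 is an arbitrary point of the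
      line.\<close>
    with False j(1) show ?thesis using that[of 0] by auto
  qed
  have "0 \<le> poly (sigma_poly R i) x" if i: "i \<in> {1..6}" for i
  proof (rule ccontr)
    let ?p = "sigma_poly R i"
    assume neg: "\<not> 0 \<le> poly ?p x"
    then have p: "?p \<in> sigma_collection R" using coll[OF i] by force
    \<comment> \<open>A root in the interval would have to be \<open>x\<close>, where
      \<open>?p\<close> is negative.\<close>
    have no_root: "poly ?p y \<noteq> 0" if "as ! j \<le> ereal y" "ereal y \<le> as ! Suc j" for y
      using unique[of y] that p neg by force
    have "poly_at ?p (as ! j) < 0"
    proof (rule ccontr)
      assume "\<not> ?thesis"
      \<comment> \<open>Partition points are never zeros, so \<open>?p\<close> is positive here and
        changes sign on the way to \<open>x\<close>.\<close>
      then have "poly_at (- ?p) (as ! j) < 0"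
        using nonzero[OF p, of "as ! j"] j(1)
        by (auto simp: poly_at_uminus ereal_uminus_less_reorder neq_iff)
      then obtain y where "as ! j < ereal y" "y \<le> x" "poly ?p y = 0"
        using poly_root_left_of_nonneg[of "- ?p" "as ! j" x] x(1) neg by auto
      with no_root[of y] x(2) show False by (meson ereal_less_eq(3) less_imp_le order_trans)
    qed
    moreover have "poly_at ?p (as ! Suc j) < 0"
    proof (rule ccontr)
      assume "\<not> ?thesis"
      then have "poly_at (- ?p) (as ! Suc j) < 0"
        using nonzero[OF p, of "as ! Suc j"] j(1)
        by (auto simp: poly_at_uminus ereal_uminus_less_reorder neq_iff)
      then obtain y where "ereal y < as ! Suc j" "x \<le> y" "poly ?p y = 0"
        using poly_root_right_of_nonneg[of "- ?p" "as ! Suc j" x] x(2) neg by auto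
      with no_root[of y] x(1) show False by (meson ereal_less_eq(3) less_imp_le order_trans)
    qed
    ultimately obtain y where "as ! j < ereal y" "ereal y < as ! Suc j" "poly ?p y = 0"
      using j(2) i unfolding interval_test_def by blast
    with no_root[of y] show False by (simp add: less_imp_le)
  qed
  then show "\<exists>x. \<forall>i\<in>{1..6}. 0 \<le> poly (sigma_poly R i) x" by blast
qed

section \<open>Termination and the returned answer\<close>

lemma exists_partition_for: "\<exists>as. partition_for R as"
proof (cases "\<exists>p\<in>sigma_collection R. \<exists>x. poly p x = 0")
  case True
  have "finite (sigma_collection R)" "0 \<notin> sigma_collection R" by (auto simp: sigma_collection_def)
  then show ?thesis
    using exists_common_root_isolating_partition True unfolding partition_for_def by simp
qed (auto simp: partition_for_def)

text \<open>The value at \<open>Start\<close> is a dummy: the first step may choose an arbitrarily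
  long partition, so the measure is used only from the second state on. The \<open>Suc\<close> makes
  \<open>loop_exit\<close> decrease it for every \<open>j\<close>.\<close>

fun remaining_steps :: "alg_state \<Rightarrow> nat" where
  "remaining_steps Start = 0"
| "remaining_steps (Loop as j answer) = Suc (length as - j)"
| "remaining_steps (Halt b) = 0"

lemma alg_terminates: "alg_terminates R"
  unfolding alg_terminates_def
proof (intro conjI notI allI impI; (elim exE conjE)?)
  fix s :: "nat \<Rightarrow> alg_state"
  assume s: "\<forall>n. alg_step R (s n) (s (Suc n))"
  have "(s (Suc (Suc n)), s (Suc n)) \<in> Wellfounded.measure remaining_steps" for n
  proof -
    \<comment> \<open>No step leads into \<open>Start\<close>.\<close>
    have "s (Suc n) \<noteq> Start" using s[rule_format, of n] by (auto elim: alg_step.cases)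
    with s[rule_format, of "Suc n"] show ?thesis by (auto elim!: alg_step.cases)
  qed
  then have "\<exists>f. \<forall>i. (f (Suc i), f i) \<in> Wellfounded.measure remaining_steps"
    by (intro exI[of _ "\<lambda>n. s (Suc n)"] allI)
  then show False using wf_measure wf_iff_no_infinite_down_chain by blast
next
  fix s assume stuck: "\<nexists>s'. alg_step R s s'"
  show "\<exists>b. s = Halt b"
  proof (cases s)
    case Start
    with stuck exists_partition_for[of R] show ?thesis by (blast intro: choose_partition)
  next
    case (Loop as j answer)
    with stuck show ?thesis by (blast intro: loop_body loop_exit)
  qed blast
qed

lemma alg_returns_iff_test:
  assumes "alg_returns R b"
  obtains as where "partition_for R as"
    "b \<longleftrightarrow> (\<exists>j. Suc j < length as \<and> interval_test R as j)"
proof -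
  \<comment> \<open>Loop invariant: \<open>answer\<close> records whether one of the intervals
    before \<open>j\<close> has passed the test.\<close>
  have "case s of
      Start \<Rightarrow> True
    | Loop as j answer \<Rightarrow> partition_for R as \<and> j < length as \<and> answer = (\<exists>k<j. interval_test R as k)
    | Halt b \<Rightarrow> \<exists>as. partition_for R as \<and> b = (\<exists>k. Suc k < length as \<and> interval_test R as k)"
    if "(alg_step R)\<^sup>*\<^sup>* Start s" for s
    using that
  proof (induction rule: rtranclp_induct)
    case (step s s')
    from step.hyps(2) step.IH show ?case
    proof cases
      case (choose_partition as)
      then have "as \<noteq> []"
        by (auto simp: partition_for_def common_root_isolating_partition_def split: if_splits)
      with choose_partition show ?thesis by simp
    next
      case (loop_body j as answer)
      with step.IH show ?thesis by (auto simp: less_Suc_eq)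
    next
      case (loop_exit j as answer)
      \<comment> \<open>The invariant \<open>j < length as\<close> fixes \<open>j\<close> at exit,
        so the intervals before \<open>j\<close> are all intervals.\<close>
      with step.IH have "Suc j = length as" by simp
      then have "k < j \<longleftrightarrow> Suc k < length as" for k by auto
      with loop_exit step.IH show ?thesis by auto
    qed
  qed simp
  from this[of "Halt b"] assms that show ?thesis unfolding alg_returns_def by auto
qed

theorem proposition5p11:
  fixes R :: bivector_endo
  assumes "R \<in> Sym2b"
  shows "alg_terminates R \<and> (\<forall>b. alg_returns R b \<longrightarrow> (b \<longleftrightarrow> sec_nonneg R))"
proof (intro conjI allI impI alg_terminates)
  fix b assume "alg_returns R b"
  then obtain as where "partition_for R as"
    "b \<longleftrightarrow> (\<exists>j. Suc j < length as \<and> interval_test R as j)"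
    by (rule alg_returns_iff_test)
  moreover have "transpose R = R" using assms by (simp add: Sym2b_def)
  ultimately show "b \<longleftrightarrow> sec_nonneg R"
    by (simp add: interval_test_iff sec_nonneg_iff_exists_psd psd_iff_sigma_nonneg)
qed

end
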